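(* Let $X$ and $Y$ be Banach spaces with $Y\neq\{0\}$. If $Y$ is finitely representable in $\ell_1$ and has the metric approximation property (MAP), and the norm of $X$ is octahedral, then the operator norm of $H$ is octahedral whenever $H$ is a linear subspace of $L(Y,X)$ containing the space of (bounded) finite-rank operators from $Y$ to $X$.
   Context: All Banach spaces are real. $L(Y,X)$ is the space of bounded linear operators from $Y$ to $X$ with the operator norm; $H$ carries the restricted norm. The norm of a normed space $Z$ is octahedral if for every finite-dimensional subspace $E$ of $Z$ and every $\varepsilon>0$ there is $z\in Z$ with $\|z\|=1$ such that $\|y+\lambda z\|\geq(1-\varepsilon)(\|y\|+|\lambda|)$ for all $y\in E$, $\lambda\in\mathbb{R}$. $Y$ is finitely representable in $\ell_1$ if for every finite-dimensional subspace $E\subseteq Y$ and every $\varepsilon>0$ there is a linear map $T:E\to\ell_1$ that is an isomorphism onto its image with $\|T\|\,\|T^{-1}\|\leq 1+\varepsilon$ (where $T^{-1}:T(E)\to E$). $Y$ has the MAP if for every compact set $K\subseteq Y$ and every $\varepsilon>0$ there is a finite-rank bounded linear operator $P:Y\to Y$ with $\|P\|\leq 1$ and $\|P(y)-y\|\leq\varepsilon$ for all $y\in K$. *)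

theory Defs
  imports "HOL-Analysis.Analysis"
begin

section \<open>The sequence space \<open>\<ell>\<^sub>1\<close>\<close>

typedef l1 = "{x :: nat \<Rightarrow> real. summable (\<lambda>n. \<bar>x n\<bar>)}"
  morphisms l1_nth Abs_l1
  by (rule exI[of _ "\<lambda>_. 0"]) simp

setup_lifting type_definition_l1

lemma summable_l1_nth: "summable (\<lambda>n. \<bar>l1_nth x n\<bar>)"
  using l1_nth[of x] by simp

lemma summable_abs_add:
  fixes x y :: "nat \<Rightarrow> real"
  assumes "summable (\<lambda>n. \<bar>x n\<bar>)" "summable (\<lambda>n. \<bar>y n\<bar>)"
  shows "summable (\<lambda>n. \<bar>x n + y n\<bar>)"
  by (rule summable_comparison_test'[OF summable_add[OF assms]]) (simp add: abs_triangle_ineq)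

instantiation l1 :: real_normed_vector
begin

lift_definition zero_l1 :: l1 is "\<lambda>_. 0" by simp

lift_definition plus_l1 :: "l1 \<Rightarrow> l1 \<Rightarrow> l1" is "\<lambda>x y n. x n + y n"
  by (rule summable_abs_add)

lift_definition uminus_l1 :: "l1 \<Rightarrow> l1" is "\<lambda>x n. - x n" by simp

lift_definition minus_l1 :: "l1 \<Rightarrow> l1 \<Rightarrow> l1" is "\<lambda>x y n. x n - y n"
  subgoal for x y using summable_abs_add[of x "\<lambda>n. - y n"] by simp
  done

lift_definition scaleR_l1 :: "real \<Rightarrow> l1 \<Rightarrow> l1" is "\<lambda>c x n. c * x n"
  by (simp add: abs_mult summable_mult)

lift_definition norm_l1 :: "l1 \<Rightarrow> real" is "\<lambda>x. \<Sum>n. \<bar>x n\<bar>" .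

definition dist_l1 :: "l1 \<Rightarrow> l1 \<Rightarrow> real" where
  "dist_l1 x y = norm (x - y)"

definition sgn_l1 :: "l1 \<Rightarrow> l1" where
  "sgn_l1 x = inverse (norm x) *\<^sub>R x"

definition uniformity_l1 :: "(l1 \<times> l1) filter" where
  "uniformity_l1 = (INF e\<in>{0<..}. principal {(x, y). dist x y < e})"

definition open_l1 :: "l1 set \<Rightarrow> bool" where
  "open_l1 U \<longleftrightarrow> (\<forall>x\<in>U. \<forall>\<^sub>F (x', y) in uniformity. x' = x \<longrightarrow> y \<in> U)"

instance
proof
  fix x y z :: l1 and a b :: real
  show "x + y + z = x + (y + z)" by transfer (simp add: add.assoc)
  show "x + y = y + x" by transfer (simp add: add.commute)
  show "0 + x = x" by transfer simp
  show "- x + x = 0" by transfer simp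
  show "x - y = x + - y" by transfer simp
  show "a *\<^sub>R (x + y) = a *\<^sub>R x + a *\<^sub>R y" by transfer (simp add: distrib_left)
  show "(a + b) *\<^sub>R x = a *\<^sub>R x + b *\<^sub>R x" by transfer (simp add: distrib_right)
  show "a *\<^sub>R b *\<^sub>R x = (a * b) *\<^sub>R x" by transfer (simp add: mult.assoc)
  show "1 *\<^sub>R x = x" by transfer simp
  show "dist x y = norm (x - y)" by (rule dist_l1_def)
  show "sgn x = inverse (norm x) *\<^sub>R x" by (rule sgn_l1_def)
  show "(uniformity :: (l1 \<times> l1) filter) = (INF e\<in>{0<..}. principal {(x, y). dist x y < e})"
    by (rule uniformity_l1_def)
  show "open U \<longleftrightarrow> (\<forall>x\<in>U. \<forall>\<^sub>F (x', y) in uniformity. x' = x \<longrightarrow> y \<in> U)" for U :: "l1 set"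
    by (rule open_l1_def)
  show "norm x = 0 \<longleftrightarrow> x = 0" by transfer (auto simp: suminf_eq_zero_iff)
  show "norm (x + y) \<le> norm x + norm y"
    by transfer
      (auto simp: suminf_add intro!: suminf_le summable_abs_add summable_add abs_triangle_ineq)
  show "norm (a *\<^sub>R x) = \<bar>a\<bar> * norm x" by transfer (simp add: abs_mult suminf_mult)
qed

end

section \<open>Finite-dimensional subspaces and octahedral norms\<close>

text \<open>The library's \<open>dim\<close> of an infinite-dimensional subspace is \<open>0\<close>, so finite
  dimensionality is expressed by a finite spanning set.\<close>

definition finite_dim_subspace :: "'a::real_vector set \<Rightarrow> bool" where
  "finite_dim_subspace E \<longleftrightarrow> subspace E \<and> (\<exists>B. finite B \<and> span B = E)"

text \<open>Octahedrality of the norm of a normed space \<open>Z\<close>, where \<open>Z\<close> is a linear subspace of the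
  ambient type with the restricted norm; take \<open>Z = UNIV\<close> for the whole type.\<close>

definition octahedral :: "'a::real_normed_vector set \<Rightarrow> bool" where
  "octahedral Z \<longleftrightarrow>
    (\<forall>E \<epsilon>. finite_dim_subspace E \<and> E \<subseteq> Z \<and> 0 < \<epsilon> \<longrightarrow>
      (\<exists>z\<in>Z. norm z = 1 \<and>
        (\<forall>y\<in>E. \<forall>c::real. norm (y + c *\<^sub>R z) \<ge> (1 - \<epsilon>) * (norm y + \<bar>c\<bar>))))"

section \<open>Finite representability in \<open>\<ell>\<^sub>1\<close>\<close>

text \<open>The library's \<^const>\<open>bounded_linear\<close> and \<^const>\<open>onorm\<close> are about maps on a whole type; here
  maps are only considered on a subspace \<open>E\<close>, and their values outside \<open>E\<close> are irrelevant.\<close>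

definition bounded_linear_on ::
    "'a::real_normed_vector set \<Rightarrow> ('a \<Rightarrow> 'b::real_normed_vector) \<Rightarrow> bool" where
  "bounded_linear_on E T \<longleftrightarrow>
    (\<forall>x\<in>E. \<forall>y\<in>E. T (x + y) = T x + T y) \<and>
    (\<forall>x\<in>E. \<forall>c. T (c *\<^sub>R x) = c *\<^sub>R T x) \<and>
    (\<exists>K. \<forall>x\<in>E. norm (T x) \<le> norm x * K)"

definition onorm_on ::
    "'a::real_normed_vector set \<Rightarrow> ('a \<Rightarrow> 'b::real_normed_vector) \<Rightarrow> real" where
  "onorm_on E T = (SUP x\<in>{x\<in>E. norm x \<le> 1}. norm (T x))"

definition isomorphism_onto_image ::
    "'a::real_normed_vector set \<Rightarrow> ('a \<Rightarrow> 'b::real_normed_vector) \<Rightarrow> bool" where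
  "isomorphism_onto_image E T \<longleftrightarrow>
    bounded_linear_on E T \<and> inj_on T E \<and> bounded_linear_on (T ` E) (the_inv_into E T)"

definition finitely_representable_in_l1 :: "'a::real_normed_vector itself \<Rightarrow> bool" where
  "finitely_representable_in_l1 _ \<longleftrightarrow>
    (\<forall>(E :: 'a set) \<epsilon>. finite_dim_subspace E \<and> 0 < \<epsilon> \<longrightarrow>
      (\<exists>T :: 'a \<Rightarrow> l1. isomorphism_onto_image E T \<and>
        onorm_on E T * onorm_on (T ` E) (the_inv_into E T) \<le> 1 + \<epsilon>))"

section \<open>Finite-rank operators and the metric approximation property\<close>

definition finite_rank :: "('a::real_normed_vector \<Rightarrow>\<^sub>L 'b::real_normed_vector) \<Rightarrow> bool" where
  "finite_rank T \<longleftrightarrow> finite_dim_subspace (range (blinfun_apply T))"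

definition metric_approximation_property :: "'a::real_normed_vector itself \<Rightarrow> bool" where
  "metric_approximation_property _ \<longleftrightarrow>
    (\<forall>(K :: 'a set) \<epsilon>. compact K \<and> 0 < \<epsilon> \<longrightarrow>
      (\<exists>P :: 'a \<Rightarrow>\<^sub>L 'a. finite_rank P \<and> norm P \<le> 1 \<and>
        (\<forall>y\<in>K. norm (blinfun_apply P y - y) \<le> \<epsilon>)))"

end

theory Submission
  imports Defs
begin

text \<open>
  Let \<open>E \<subseteq> H\<close> be finite-dimensional. Its unit ball is compact, so finitely many unit
  vectors \<open>y \<in> A\<close> almost attain the norm of every operator in \<open>E\<close> (\<open>finite_norming_set\<close>).
  It therefore suffices to find a contraction \<open>S\<close> of finite rank with
  \<open>\<parallel>T y + c S y\<parallel> \<approx> \<parallel>T y\<parallel> + \<bar>c\<bar>\<close> for \<open>T \<in> E\<close> and \<open>y \<in> A\<close>: testing \<open>T + c S\<close> on a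
  vector of \<open>A\<close> that almost norms \<open>T\<close> gives the octahedral inequality.

  The vectors \<open>T y\<close> span a finite-dimensional subspace \<open>G\<close> of \<open>X\<close>. Since \<open>X\<close> is octahedral,
  one can choose unit vectors one after another and obtain a copy of \<open>\<ell>\<^sub>1\<^sup>n\<close> in \<open>X\<close>, for
  each \<open>n\<close>, whose sum with \<open>G\<close> is almost an \<open>\<ell>\<^sub>1\<close>-sum (\<open>octahedral_l1_sequence\<close>). So any
  contraction \<open>Y \<rightarrow> \<ell>\<^sub>1\<^sup>n\<close> that almost preserves the norms of the vectors of \<open>A\<close> produces
  such an \<open>S\<close>. To find that contraction, MAP supplies a contraction \<open>P\<close> of finite rank that
  almost fixes \<open>A\<close>, finite representability embeds the range of \<open>P\<close> almost isometrically
  into \<open>\<ell>\<^sub>1\<close>, and truncating to the first \<open>n\<close> coordinates loses little at the finitely many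
  vectors of \<open>A\<close> (\<open>finite_rank_almost_isometric_coordinates\<close>).
\<close>

section \<open>Finite-dimensional subspaces of normed spaces\<close>

lemma finite_dim_subspace_if_subset_span:
  assumes "subspace V" "V \<subseteq> span B" "finite B"
  shows "finite_dim_subspace V"
proof -
  obtain C where C: "C \<subseteq> V" "independent C" "V \<subseteq> span C"
    using maximal_independent_subset by blast
  then have "finite C"
    using independent_span_bound[OF assms(3), of C] assms(2) by blast
  moreover have "span C = V"
    using C assms(1) by (meson span_minimal subset_antisym)
  ultimately show ?thesis
    using assms(1) unfolding finite_dim_subspace_def by blast
qed

text \<open>If bounded parts of \<open>E\<close> lie in compact subsets of \<open>E\<close>, then \<open>E\<close> is closed, so a vector
  \<open>b\<close> outside \<open>E\<close> has positive distance \<open>d\<close> from \<open>E\<close>. Then \<open>\<parallel>x + c b\<parallel> \<ge> \<bar>c\<bar> d\<close> bounds the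
  coordinate \<open>c\<close>, hence also \<open>\<parallel>x\<parallel>\<close>, on bounded parts of the sum of \<open>E\<close> and the line through \<open>b\<close>,
  and the property passes to this sum.\<close>

lemma bounded_part_of_finite_span_in_compact:
  fixes B :: "'a::real_normed_vector set"
  assumes "finite B"
  shows "\<exists>K. compact K \<and> K \<subseteq> span B \<and> span B \<inter> cball 0 r \<subseteq> K"
  using assms
proof (induction B arbitrary: r rule: finite_induct)
  case empty
  show ?case by (rule exI[of _ "{0}"]) auto
next
  case (insert b B)
  show ?case
  proof (cases "b \<in> span B")
    case True
    then show ?thesis using insert.IH[of r] by (simp add: span_redundant)
  next
    case False
    have closed: "closed (span B)"
      unfolding closed_sequential_limits
    proof (intro allI impI)
      fix u l assume u: "(\<forall>n. u n \<in> span B) \<and> u \<longlonglongrightarrow> l"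
      then have "bounded (range u)"
        using convergent_imp_bounded by blast
      then obtain R where "\<forall>x\<in>range u. norm x \<le> R"
        unfolding bounded_iff by blast
      then have R: "norm (u n) \<le> R" for n by blast
      obtain K where K: "compact K" "K \<subseteq> span B" "span B \<inter> cball 0 R \<subseteq> K"
        using insert.IH by blast
      have "u n \<in> K" for n using K(3) u R by auto
      then have "l \<in> K"
        using compact_imp_closed[OF K(1)] u closed_sequentially by blast
      then show "l \<in> span B" using K(2) by blast
    qed
    then have "open (- span B)" by (simp add: open_Compl)
    then obtain d where d: "d > 0" "ball b d \<subseteq> - span B"
      using False open_contains_ball by blast
    have dist: "d \<le> norm (b - x)" if "x \<in> span B" for x
    proof (rule ccontr)
      assume "\<not> d \<le> norm (b - x)"
      then have "x \<in> ball b d" by (simp add: dist_norm)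
      then show False using d(2) that by blast
    qed
    define R where "R = r + r / d * norm b"
    obtain K where K: "compact K" "K \<subseteq> span B" "span B \<inter> cball 0 R \<subseteq> K"
      using insert.IH by blast
    define K' where "K' = (\<lambda>(x, c). x + c *\<^sub>R b) ` (K \<times> {- (r/d)..r/d})"
    have "compact K'"
      unfolding K'_def
      by (intro compact_continuous_image compact_Times K(1) compact_Icc)
        (auto intro!: continuous_intros simp: case_prod_unfold)
    moreover have "K' \<subseteq> span (insert b B)"
    proof
      fix w assume "w \<in> K'"
      then obtain x c where w: "w = x + c *\<^sub>R b" "x \<in> K" unfolding K'_def by auto
      have "x \<in> span (insert b B)"
        using w(2) K(2) span_mono[of B "insert b B"] by auto
      moreover have "b \<in> span (insert b B)" by (simp add: span_base)
      ultimately show "w \<in> span (insert b B)"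
        using w(1) by (simp add: span_add span_scale)
    qed
    moreover have "span (insert b B) \<inter> cball 0 r \<subseteq> K'"
    proof
      fix w assume w: "w \<in> span (insert b B) \<inter> cball 0 r"
      then obtain c where c: "w - c *\<^sub>R b \<in> span B"
        using span_breakdown_eq by blast
      define x where "x = w - c *\<^sub>R b"
      have x: "x \<in> span B" using c x_def by simp
      have wr: "norm w \<le> r" using w by simp
      have "\<bar>c\<bar> * d \<le> norm w"
      proof (cases "c = 0")
        case False
        have "- (1/c) *\<^sub>R x \<in> span B" using x span_scale by blast
        then have "d \<le> norm (b - (- (1/c) *\<^sub>R x))" by (rule dist)
        also have "b - (- (1/c) *\<^sub>R x) = (1/c) *\<^sub>R w"
          using False by (simp add: x_def algebra_simps)
        also have "norm \<dots> = norm w / \<bar>c\<bar>" by simp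
        finally show ?thesis using False by (simp add: field_simps)
      qed simp
      then have cr: "\<bar>c\<bar> \<le> r / d" using wr d(1) by (simp add: field_simps)
      have "norm x \<le> norm w + \<bar>c\<bar> * norm b"
        unfolding x_def using norm_triangle_ineq4[of w "c *\<^sub>R b"] by simp
      also have "\<dots> \<le> R"
        unfolding R_def using wr cr by (intro add_mono mult_right_mono) auto
      finally have "x \<in> K" using K(3) x by auto
      then show "w \<in> K'"
        unfolding K'_def using cr by (intro image_eqI[of _ _ "(x, c)"]) (auto simp: x_def)
    qed
    ultimately show ?thesis by blast
  qed
qed

section \<open>Finite norming sets for finite-dimensional spaces of operators\<close>

lemma almost_norming_vector:
  fixes T :: "'a::real_normed_vector \<Rightarrow>\<^sub>L 'b::real_normed_vector"
  assumes "(UNIV :: 'a set) \<noteq> {0}" "0 < \<delta>" "\<delta> < 1"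
  shows "\<exists>y. norm y = 1 \<and> (1 - \<delta>) * norm T \<le> norm (T y)"
proof (rule ccontr)
  assume "\<not> ?thesis"
  then have *: "norm (T y) < (1 - \<delta>) * norm T" if "norm y = 1" for y
    using that by force
  have "norm (T y) \<le> (1 - \<delta>) * norm T * norm y" for y
  proof (cases "y = 0")
    case False
    have "norm (T ((1 / norm y) *\<^sub>R y)) < (1 - \<delta>) * norm T"
      using False by (intro *) simp
    also have "T ((1 / norm y) *\<^sub>R y) = (1 / norm y) *\<^sub>R T y"
      by (simp add: blinfun.scaleR_right)
    finally show ?thesis using False by (simp add: field_simps)
  qed simp
  then have "norm T \<le> (1 - \<delta>) * norm T"
    using assms by (intro norm_blinfun_bound) auto
  then have "T = 0"
    using assms(2) by (simp add: algebra_simps mult_le_0_iff)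
  moreover obtain v :: 'a where "v \<noteq> 0" using assms(1) by auto
  then have "norm ((1 / norm v) *\<^sub>R v) = 1" by simp
  ultimately show False using *[of "(1 / norm v) *\<^sub>R v"] by simp
qed

text \<open>Vectors that almost norm the members of a \<open>\<delta>\<close>-net of the unit sphere almost norm the whole
  sphere. The net loses \<open>\<delta>\<close> twice, once in the norm of the operator and once in its value, and
  the choice of the vector loses \<open>\<delta>\<close> a third time.\<close>

lemma finite_norming_set:
  fixes E :: "('a::real_normed_vector \<Rightarrow>\<^sub>L 'b::real_normed_vector) set"
  assumes "(UNIV :: 'a set) \<noteq> {0}" "finite_dim_subspace E" "0 < \<delta>" "\<delta> < 1"
  shows "\<exists>A. finite A \<and> (\<forall>y\<in>A. norm y = 1) \<and>
    (\<forall>T\<in>E. \<exists>y\<in>A. (1 - 3 * \<delta>) * norm T \<le> norm (blinfun_apply T y))"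
proof -
  obtain B where B: "finite B" "span B = E"
    using assms(2) unfolding finite_dim_subspace_def by blast
  obtain K where K: "compact K" "K \<subseteq> E" "E \<inter> cball 0 1 \<subseteq> K"
    using bounded_part_of_finite_span_in_compact[OF B(1), of 1] unfolding B(2) by blast
  obtain N where N: "finite N" "K \<subseteq> (\<Union>T\<in>N. ball T \<delta>)"
    using K(1) assms(3) unfolding compact_eq_totally_bounded by blast
  have "\<forall>T :: 'a \<Rightarrow>\<^sub>L 'b. \<exists>y. norm y = 1 \<and> (1 - \<delta>) * norm T \<le> norm (blinfun_apply T y)"
    using almost_norming_vector[OF assms(1,3,4)] by blast
  from choice[OF this] obtain v :: "('a \<Rightarrow>\<^sub>L 'b) \<Rightarrow> 'a"
    where v: "norm (v T) = 1" "(1 - \<delta>) * norm T \<le> norm (T (v T))" for T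
    by blast
  have sphere: "\<exists>y\<in>v ` N. 1 - 3 * \<delta> \<le> norm (T y)" if T: "T \<in> E" "norm T = 1" for T
  proof -
    have "T \<in> K" using K(3) T by auto
    then obtain T' where T': "T' \<in> N" "norm (T' - T) < \<delta>"
      using N(2) by (auto simp: dist_norm)
    have "norm T - norm T' \<le> norm (T' - T)"
      by (metis norm_minus_commute norm_triangle_ineq2)
    then have "1 - \<delta> \<le> norm T'" using T T' by simp
    then have "(1 - \<delta>) * (1 - \<delta>) \<le> (1 - \<delta>) * norm T'"
      using assms(4) by (intro mult_left_mono) auto
    also have "\<dots> \<le> norm (T' (v T'))" by (rule v)
    also have "\<dots> \<le> norm (T (v T')) + norm ((T' - T) (v T'))"
      by (metis add_diff_cancel_left' blinfun.diff_left diff_add_cancel norm_triangle_ineq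
          add.commute)
    also have "norm ((T' - T) (v T')) \<le> norm (T' - T) * norm (v T')"
      by (rule norm_blinfun)
    finally have "(1 - \<delta>) * (1 - \<delta>) \<le> norm (T (v T')) + \<delta>"
      using T' by (simp add: v)
    moreover have "1 - 2 * \<delta> \<le> (1 - \<delta>) * (1 - \<delta>)" by (simp add: algebra_simps)
    ultimately have "1 - 3 * \<delta> \<le> norm (T (v T'))" by simp
    then show ?thesis using T' by blast
  qed
  obtain y0 :: 'a where y0: "norm y0 = 1"
    using v(1) by blast
  have "\<exists>y\<in>insert y0 (v ` N). (1 - 3 * \<delta>) * norm T \<le> norm (T y)" if T: "T \<in> E" for T
  proof (cases "T = 0")
    case False
    have "(1 / norm T) *\<^sub>R T \<in> E"
      using T B(2) span_scale by blast
    moreover have "norm ((1 / norm T) *\<^sub>R T) = 1" using False by simp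
    ultimately obtain y where "y \<in> v ` N" "1 - 3 * \<delta> \<le> norm (((1 / norm T) *\<^sub>R T) y)"
      using sphere by blast
    moreover from this have "(1 - 3 * \<delta>) * norm T \<le> norm (T y)"
      using False by (simp add: blinfun.scaleR_left field_simps)
    ultimately show ?thesis by blast
  qed auto
  then show ?thesis
    using N(1) v(1) y0 by (intro exI[of _ "insert y0 (v ` N)"]) auto
qed

section \<open>Copies of \<open>\<ell>\<^sub>1\<^sup>n\<close> in octahedral spaces\<close>

text \<open>Each new vector is chosen by octahedrality relative to the span of \<open>G\<close> and its predecessors,
  at the cost of one more factor \<open>1 - \<delta>\<close>.\<close>

lemma octahedral_l1_sequence_power:
  fixes G :: "'a::real_normed_vector set"
  assumes oct: "octahedral (UNIV :: 'a set)" and "finite D" "G = span D"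
    and \<delta>: "0 < \<delta>" "\<delta> < 1"
  shows "\<exists>z. (\<forall>i<n. norm (z i) = 1) \<and> (\<forall>x\<in>G. \<forall>a::nat \<Rightarrow> real.
    (1 - \<delta>) ^ n * (norm x + (\<Sum>i<n. \<bar>a i\<bar>)) \<le> norm (x + (\<Sum>i<n. a i *\<^sub>R z i)))"
proof (induction n)
  case 0
  show ?case by simp
next
  case (Suc n)
  then obtain z where z: "\<forall>i<n. norm (z i) = 1"
    "\<And>x a. x \<in> G \<Longrightarrow> (1 - \<delta>) ^ n * (norm x + (\<Sum>i<n. \<bar>a i :: real\<bar>))
      \<le> norm (x + (\<Sum>i<n. a i *\<^sub>R z i))"
    by blast
  define F where "F = span (D \<union> z ` {..<n})"
  have "finite_dim_subspace F"
    unfolding F_def finite_dim_subspace_def using \<open>finite D\<close>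
    by (auto intro!: exI[of _ "D \<union> z ` {..<n}"])
  then obtain w where w: "norm w = 1"
    "\<And>y c. y \<in> F \<Longrightarrow> (1 - \<delta>) * (norm y + \<bar>c\<bar>) \<le> norm (y + c *\<^sub>R w)"
    using oct \<delta>(1) unfolding octahedral_def by blast
  define z' where "z' = z(n := w)"
  have sum: "(\<Sum>i<Suc n. a i *\<^sub>R z' i) = (\<Sum>i<n. a i *\<^sub>R z i) + a n *\<^sub>R w" for a
    by (simp add: z'_def)
  have "(1 - \<delta>) ^ Suc n * (norm x + (\<Sum>i<Suc n. \<bar>a i\<bar>)) \<le> norm (x + (\<Sum>i<Suc n. a i *\<^sub>R z' i))"
    if x: "x \<in> G" for x and a :: "nat \<Rightarrow> real"
  proof -
    let ?u = "x + (\<Sum>i<n. a i *\<^sub>R z i)"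
    have "x \<in> F"
      using x \<open>G = span D\<close> span_mono[of D "D \<union> z ` {..<n}"] unfolding F_def by auto
    moreover have "(\<Sum>i<n. a i *\<^sub>R z i) \<in> F"
      unfolding F_def by (intro span_sum span_scale span_base) auto
    ultimately have u: "?u \<in> F" unfolding F_def by (rule span_add)
    have "(1 - \<delta>) ^ n * \<bar>a n\<bar> \<le> \<bar>a n\<bar>"
      using \<delta> by (intro mult_left_le_one_le power_le_one zero_le_power) auto
    then have "(1 - \<delta>) ^ n * (norm x + (\<Sum>i<Suc n. \<bar>a i\<bar>)) \<le> norm ?u + \<bar>a n\<bar>"
      using z(2)[OF x, of a] by (simp add: algebra_simps)
    then have "(1 - \<delta>) * ((1 - \<delta>) ^ n * (norm x + (\<Sum>i<Suc n. \<bar>a i\<bar>)))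
      \<le> (1 - \<delta>) * (norm ?u + \<bar>a n\<bar>)"
      using \<delta> by (intro mult_left_mono) auto
    also have "\<dots> \<le> norm (?u + a n *\<^sub>R w)" by (rule w(2)[OF u])
    finally show ?thesis
      unfolding sum by (simp only: power_Suc mult.assoc add.assoc)
  qed
  moreover have "\<forall>i<Suc n. norm (z' i) = 1"
    using z(1) w(1) by (auto simp: z'_def less_Suc_eq)
  ultimately show ?case by blast
qed

lemma octahedral_l1_sequence:
  fixes G :: "'a::real_normed_vector set"
  assumes "octahedral (UNIV :: 'a set)" "finite D" "G = span D" "0 < \<delta>" "\<delta> < 1"
  shows "\<exists>z. (\<forall>i<n. norm (z i) = 1) \<and> (\<forall>x\<in>G. \<forall>a::nat \<Rightarrow> real.
    (1 - \<delta>) * (norm x + (\<Sum>i<n. \<bar>a i\<bar>)) \<le> norm (x + (\<Sum>i<n. a i *\<^sub>R z i)))"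
proof -
  define \<eta> where "\<eta> = \<delta> / Suc n"
  have \<eta>: "0 < \<eta>" "\<eta> < 1" "real n * \<eta> \<le> \<delta>"
    using assms(4,5) by (auto simp: \<eta>_def field_simps)
  have "1 - \<delta> \<le> 1 + real n * (- \<eta>)" using \<eta> by simp
  also have "\<dots> \<le> (1 + (- \<eta>)) ^ n" using \<eta> by (intro Bernoulli_inequality) simp
  finally have *: "1 - \<delta> \<le> (1 - \<eta>) ^ n" by simp
  obtain z where z: "\<forall>i<n. norm (z i) = 1"
    "\<And>x a. x \<in> G \<Longrightarrow> (1 - \<eta>) ^ n * (norm x + (\<Sum>i<n. \<bar>a i :: real\<bar>))
      \<le> norm (x + (\<Sum>i<n. a i *\<^sub>R z i))"
    using octahedral_l1_sequence_power[OF assms(1-3) \<eta>(1,2), of n] by blast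
  have "(1 - \<delta>) * (norm x + (\<Sum>i<n. \<bar>a i\<bar>)) \<le> norm (x + (\<Sum>i<n. a i *\<^sub>R z i))"
    if "x \<in> G" for x and a :: "nat \<Rightarrow> real"
    using mult_right_mono[OF *, of "norm x + (\<Sum>i<n. \<bar>a i\<bar>)"] z(2)[OF that, of a]
    by (simp add: sum_nonneg add_nonneg_nonneg)
  then show ?thesis using z(1) by blast
qed

section \<open>Almost isometric coordinates from finite representability and MAP\<close>

lemma norm_le_onorm_on:
  assumes "bounded_linear_on E T" "subspace E" "x \<in> E"
  shows "norm (T x) \<le> onorm_on E T * norm x"
proof (cases "x = 0")
  case True
  have "T (0 *\<^sub>R x) = 0 *\<^sub>R T x"
    using assms unfolding bounded_linear_on_def by blast
  then show ?thesis using True by simp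
next
  case False
  obtain K where K: "\<forall>x\<in>E. norm (T x) \<le> norm x * K"
    using assms(1) unfolding bounded_linear_on_def by blast
  have "bdd_above ((\<lambda>x. norm (T x)) ` {x\<in>E. norm x \<le> 1})"
  proof (rule bdd_aboveI2)
    fix x assume x: "x \<in> {x\<in>E. norm x \<le> 1}"
    then have "norm (T x) \<le> norm x * K" using K by blast
    also have "\<dots> \<le> norm x * \<bar>K\<bar>" by (intro mult_left_mono) auto
    also have "\<dots> \<le> \<bar>K\<bar>" using x by (intro mult_left_le_one_le) auto
    finally show "norm (T x) \<le> \<bar>K\<bar>" .
  qed
  moreover have mem: "(1 / norm x) *\<^sub>R x \<in> {x\<in>E. norm x \<le> 1}"
    using assms(2,3) False by (simp add: subspace_scale)
  ultimately have "norm (T ((1 / norm x) *\<^sub>R x)) \<le> onorm_on E T"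
    unfolding onorm_on_def by (rule cSUP_upper[rotated])
  moreover have "T ((1 / norm x) *\<^sub>R x) = (1 / norm x) *\<^sub>R T x"
    using assms unfolding bounded_linear_on_def by blast
  ultimately show ?thesis using False by (simp add: field_simps)
qed

text \<open>Dividing the given isomorphism by its norm makes it a contraction and leaves the whole
  distortion to the inverse. If its norm is \<open>0\<close>, then \<open>E = {0}\<close>, and the default value of
  the division is harmless.\<close>

lemma almost_isometric_contraction_into_l1:
  fixes E :: "'a::real_normed_vector set"
  assumes "finitely_representable_in_l1 TYPE('a)" "finite_dim_subspace E" "0 < \<delta>"
  shows "\<exists>\<psi> :: 'a \<Rightarrow> l1. (\<forall>x\<in>E. \<forall>y\<in>E. \<psi> (x + y) = \<psi> x + \<psi> y) \<and>
    (\<forall>x\<in>E. \<forall>c. \<psi> (c *\<^sub>R x) = c *\<^sub>R \<psi> x) \<and>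
    (\<forall>x\<in>E. norm (\<psi> x) \<le> norm x \<and> norm x \<le> (1 + \<delta>) * norm (\<psi> x))"
proof -
  obtain T :: "'a \<Rightarrow> l1" where iso: "isomorphism_onto_image E T" and
    dist: "onorm_on E T * onorm_on (T ` E) (the_inv_into E T) \<le> 1 + \<delta>"
    using assms unfolding finitely_representable_in_l1_def by blast
  have E: "subspace E" using assms(2) unfolding finite_dim_subspace_def by blast
  have T: "bounded_linear_on E T" and inj: "inj_on T E"
    and inv: "bounded_linear_on (T ` E) (the_inv_into E T)"
    using iso unfolding isomorphism_onto_image_def by auto
  have add: "T (x + y) = T x + T y" if "x \<in> E" "y \<in> E" for x y
    using T that unfolding bounded_linear_on_def by blast
  have scale: "T (c *\<^sub>R x) = c *\<^sub>R T x" if "x \<in> E" for c x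
    using T that unfolding bounded_linear_on_def by blast
  have zero: "T 0 = 0" using scale[of 0 0] E by (simp add: subspace_0)
  have TE: "subspace (T ` E)"
  proof (rule subspaceI)
    show "0 \<in> T ` E" using zero E by (metis image_eqI subspace_0)
    show "x + y \<in> T ` E" if "x \<in> T ` E" "y \<in> T ` E" for x y
      using that subspace_add[OF E] by (auto simp: add[symmetric])
    show "c *\<^sub>R x \<in> T ` E" if "x \<in> T ` E" for c x
      using that subspace_scale[OF E] by (auto simp: scale[symmetric])
  qed
  define a where "a = onorm_on E T"
  define b where "b = onorm_on (T ` E) (the_inv_into E T)"
  have up: "norm (T x) \<le> a * norm x" if "x \<in> E" for x
    unfolding a_def by (rule norm_le_onorm_on[OF T E that])
  have low: "norm x \<le> b * norm (T x)" if "x \<in> E" for x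
    using norm_le_onorm_on[OF inv TE, of "T x"] that
    by (simp add: b_def the_inv_into_f_f[OF inj])
  have bound: "norm ((1 / a) *\<^sub>R T x) \<le> norm x \<and>
    norm x \<le> (1 + \<delta>) * norm ((1 / a) *\<^sub>R T x)" if x: "x \<in> E" for x
  proof (cases "x = 0")
    case False
    then have "T x \<noteq> 0" using low[OF x] by auto
    moreover have "0 < norm (T x)" using calculation by simp
    ultimately have a: "0 < a"
      using up[OF x] False by (smt (verit) mult_nonpos_nonneg norm_ge_zero)
    have "norm x * a \<le> (b * norm (T x)) * a" using low[OF x] a by (intro mult_right_mono) auto
    also have "\<dots> = (a * b) * norm (T x)" by simp
    also have "\<dots> \<le> (1 + \<delta>) * norm (T x)"
      using dist unfolding a_def b_def by (intro mult_right_mono) auto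
    finally show ?thesis using up[OF x] a by (simp add: field_simps)
  qed (simp add: zero)
  show ?thesis
    using bound by (intro exI[of _ "\<lambda>x. (1 / a) *\<^sub>R T x"])
      (simp add: add scale scaleR_add_right)
qed

lemma sum_abs_le_norm_l1: "(\<Sum>i<n. \<bar>l1_nth x i\<bar>) \<le> norm x"
  unfolding norm_l1.rep_eq by (rule sum_le_suminf[OF summable_l1_nth]) auto

lemma sum_abs_tendsto_norm_l1: "(\<lambda>n. \<Sum>i<n. \<bar>l1_nth x i\<bar>) \<longlonglongrightarrow> norm x"
  unfolding norm_l1.rep_eq by (rule summable_LIMSEQ[OF summable_l1_nth])

text \<open>The functions \<open>f i\<close> are the first \<open>n\<close> coordinates of a contraction \<open>Y \<rightarrow> \<ell>\<^sub>1\<close>, the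
  composition of a finite-rank operator that almost fixes \<open>A\<close> with an almost isometric embedding
  of its range. Truncation never increases the norm in \<open>\<ell>\<^sub>1\<close>, and the lower bound is required only
  at finitely many points, so some \<open>n\<close> serves them all.\<close>

lemma finite_rank_almost_isometric_coordinates:
  fixes A :: "'a::real_normed_vector set"
  assumes "finitely_representable_in_l1 TYPE('a)" "metric_approximation_property TYPE('a)"
    and A: "finite A" "\<And>y. y \<in> A \<Longrightarrow> norm y = 1" and \<delta>: "0 < \<delta>" "\<delta> < 1"
  shows "\<exists>n f. (\<forall>i. linear (f i :: 'a \<Rightarrow> real)) \<and>
    (\<forall>y. (\<Sum>i<n. \<bar>f i y\<bar>) \<le> norm y) \<and> (\<forall>y\<in>A. 1 - 3 * \<delta> \<le> (\<Sum>i<n::nat. \<bar>f i y\<bar>))"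
proof -
  obtain P :: "'a \<Rightarrow>\<^sub>L 'a" where P: "finite_rank P" "norm P \<le> 1"
    "\<forall>y\<in>A. norm (P y - y) \<le> \<delta>"
    using assms(2) finite_imp_compact[OF A(1)] \<delta>(1)
    unfolding metric_approximation_property_def by blast
  obtain \<psi> :: "'a \<Rightarrow> l1" where
    add: "\<And>u v. \<psi> (P u + P v) = \<psi> (P u) + \<psi> (P v)" and
    scale: "\<And>c u. \<psi> (c *\<^sub>R P u) = c *\<^sub>R \<psi> (P u)" and
    up: "\<And>u. norm (\<psi> (P u)) \<le> norm (P u)" and
    low: "\<And>u. norm (P u) \<le> (1 + \<delta>) * norm (\<psi> (P u))"
    using almost_isometric_contraction_into_l1[OF assms(1) P(1)[unfolded finite_rank_def] \<delta>(1)]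
    by blast
  define f where "f i y = l1_nth (\<psi> (P y)) i" for i y
  have lin: "linear (f i)" for i
    by (rule linearI)
      (simp_all add: f_def blinfun.add_right blinfun.scaleR_right add scale
        plus_l1.rep_eq scaleR_l1.rep_eq)
  have contr: "(\<Sum>i<n. \<bar>f i y\<bar>) \<le> norm y" for n y
  proof -
    have "(\<Sum>i<n. \<bar>f i y\<bar>) \<le> norm (\<psi> (P y))"
      unfolding f_def by (rule sum_abs_le_norm_l1)
    also have "\<dots> \<le> norm (P y)" by (rule up)
    also have "\<dots> \<le> norm P * norm y" by (rule norm_blinfun)
    also have "\<dots> \<le> norm y" using P(2) by (intro mult_left_le_one_le) auto
    finally show ?thesis .
  qed
  have "\<forall>\<^sub>F n in sequentially. 1 - 3 * \<delta> \<le> (\<Sum>i<n. \<bar>f i y\<bar>)" if y: "y \<in> A" for y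
  proof -
    have "norm y - norm (P y) \<le> norm (P y - y)"
      by (metis norm_minus_commute norm_triangle_ineq2)
    moreover have "norm (P y - y) \<le> \<delta>" using P(3) y by blast
    ultimately have "1 - \<delta> \<le> norm (P y)" using A(2)[OF y] by simp
    also have "\<dots> \<le> (1 + \<delta>) * norm (\<psi> (P y))" by (rule low)
    finally have "1 - \<delta> \<le> (1 + \<delta>) * norm (\<psi> (P y))" .
    moreover have "(1 + \<delta>) * (1 - 3 * \<delta>) < 1 - \<delta>"
      using \<delta> by (simp add: algebra_simps add_pos_pos)
    ultimately have "(1 + \<delta>) * (1 - 3 * \<delta>) < (1 + \<delta>) * norm (\<psi> (P y))" by simp
    then have "1 - 3 * \<delta> < norm (\<psi> (P y))"
      using \<delta>(1) by simp
    then have "\<forall>\<^sub>F n in sequentially. 1 - 3 * \<delta> < (\<Sum>i<n. \<bar>f i y\<bar>)"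
      unfolding f_def by (rule order_tendstoD(1)[OF sum_abs_tendsto_norm_l1])
    then show ?thesis by (rule eventually_mono) simp
  qed
  then have "\<forall>\<^sub>F n in sequentially. \<forall>y\<in>A. 1 - 3 * \<delta> \<le> (\<Sum>i<n. \<bar>f i y\<bar>)"
    using A(1) by (simp add: eventually_ball_finite)
  then obtain n where "\<forall>y\<in>A. 1 - 3 * \<delta> \<le> (\<Sum>i<n. \<bar>f i y\<bar>)"
    by (auto simp: eventually_sequentially)
  then show ?thesis using lin contr by blast
qed

section \<open>Octahedrality of spaces of operators\<close>

text \<open>The operator is \<open>y \<mapsto> \<Sum>i<n. f i y *\<^sub>R z i\<close>, where the \<open>f i\<close> are almost isometric coordinates
  on \<open>A\<close> and the \<open>z i\<close> span a copy of \<open>\<ell>\<^sub>1\<^sup>n\<close> that is almost \<open>\<ell>\<^sub>1\<close>-independent of \<open>G\<close>.\<close>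

lemma finite_rank_contraction_almost_l1_independent:
  fixes A :: "'a::real_normed_vector set" and D :: "'b::real_normed_vector set"
  assumes "finitely_representable_in_l1 TYPE('a)" "metric_approximation_property TYPE('a)"
    and "octahedral (UNIV :: 'b set)"
    and A: "finite A" "\<And>y. y \<in> A \<Longrightarrow> norm y = 1"
    and D: "finite D" and \<delta>: "0 < \<delta>" "\<delta> < 1"
  shows "\<exists>S :: 'a \<Rightarrow>\<^sub>L 'b. finite_rank S \<and> norm S \<le> 1 \<and>
    (\<forall>x\<in>span D. \<forall>y\<in>A. \<forall>c. (1 - \<delta>) * (norm x + \<bar>c\<bar> * (1 - 3 * \<delta>)) \<le> norm (x + c *\<^sub>R S y))"
proof -
  obtain n and f :: "nat \<Rightarrow> 'a \<Rightarrow> real" where lin: "\<And>i. linear (f i)"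
    and contr: "\<And>y. (\<Sum>i<n. \<bar>f i y\<bar>) \<le> norm y"
    and low: "\<And>y. y \<in> A \<Longrightarrow> 1 - 3 * \<delta> \<le> (\<Sum>i<n. \<bar>f i y\<bar>)"
    using finite_rank_almost_isometric_coordinates[OF assms(1,2) A \<delta>] by blast
  obtain z :: "nat \<Rightarrow> 'b" where z: "\<forall>i<n. norm (z i) = 1"
    "\<And>x a. x \<in> span D \<Longrightarrow> (1 - \<delta>) * (norm x + (\<Sum>i<n. \<bar>a i :: real\<bar>))
      \<le> norm (x + (\<Sum>i<n. a i *\<^sub>R z i))"
    using octahedral_l1_sequence[OF assms(3) D refl \<delta>, of n] by blast
  define s where "s y = (\<Sum>i<n. f i y *\<^sub>R z i)" for y
  have s_le: "norm (s y) \<le> norm y" for y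
  proof -
    have "norm (s y) \<le> (\<Sum>i<n. norm (f i y *\<^sub>R z i))"
      unfolding s_def by (rule norm_sum)
    also have "\<dots> = (\<Sum>i<n. \<bar>f i y\<bar>)" using z(1) by simp
    finally show ?thesis using contr[of y] by simp
  qed
  have "bounded_linear s"
  proof (rule bounded_linear_intro)
    show "s (u + v) = s u + s v" for u v
      by (simp add: s_def linear_add[OF lin] scaleR_add_left sum.distrib)
    show "s (r *\<^sub>R u) = r *\<^sub>R s u" for r u
      by (simp add: s_def linear_cmul[OF lin] scaleR_sum_right)
    show "norm (s u) \<le> norm u * 1" for u using s_le by simp
  qed
  then obtain S :: "'a \<Rightarrow>\<^sub>L 'b" where S: "blinfun_apply S = s"
    using bounded_linear_Blinfun_apply by blast
  have "range s \<subseteq> span (z ` {..<n})"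
    unfolding s_def by (auto intro!: span_sum span_scale intro: span_base)
  moreover have "subspace (range s)"
    using \<open>bounded_linear s\<close> by (simp add: bounded_linear.linear linear_subspace_image)
  ultimately have rank: "finite_rank S"
    unfolding finite_rank_def S
    using finite_dim_subspace_if_subset_span[of "range s" "z ` {..<n}"] by blast
  have norm: "norm S \<le> 1"
    using s_le by (intro norm_blinfun_bound) (simp_all add: S)
  have "(1 - \<delta>) * (norm x + \<bar>c\<bar> * (1 - 3 * \<delta>)) \<le> norm (x + c *\<^sub>R S y)"
    if x: "x \<in> span D" and y: "y \<in> A" for x y c
  proof -
    have "(1 - \<delta>) * (norm x + \<bar>c\<bar> * (1 - 3 * \<delta>)) \<le> (1 - \<delta>) * (norm x + \<bar>c\<bar> * (\<Sum>i<n. \<bar>f i y\<bar>))"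
      using low[OF y] \<delta> by (intro mult_left_mono add_left_mono) auto
    also have "\<dots> = (1 - \<delta>) * (norm x + (\<Sum>i<n. \<bar>c * f i y\<bar>))"
      by (simp add: sum_distrib_left abs_mult)
    also have "\<dots> \<le> norm (x + (\<Sum>i<n. (c * f i y) *\<^sub>R z i))" by (rule z(2)[OF x])
    also have "(\<Sum>i<n. (c * f i y) *\<^sub>R z i) = c *\<^sub>R S y"
      by (simp add: S s_def scaleR_sum_right)
    finally show ?thesis .
  qed
  then show ?thesis using rank norm by blast
qed

theorem theorem3p2:
  fixes H :: "('y::banach \<Rightarrow>\<^sub>L 'x::banach) set"
  assumes "(UNIV :: 'y set) \<noteq> {0}"
    and "finitely_representable_in_l1 TYPE('y)"
    and "metric_approximation_property TYPE('y)"
    and "octahedral (UNIV :: 'x set)"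
    and "subspace H"
    and "{T. finite_rank T} \<subseteq> H"
  shows "octahedral H"
  unfolding octahedral_def
proof (intro allI impI, elim conjE)
  fix E :: "('y \<Rightarrow>\<^sub>L 'x) set" and \<epsilon> :: real
  assume E: "finite_dim_subspace E" "E \<subseteq> H" and "0 < \<epsilon>"
  \<comment> \<open>The losses add up to \<open>4 \<delta>\<close>. It has to be at most \<open>\<epsilon>\<close>, and below \<open>1\<close> so that \<open>S \<noteq> 0\<close>.\<close>
  define \<delta> where "\<delta> = min \<epsilon> 1 / 8"
  have \<delta>: "0 < \<delta>" "\<delta> < 1" "4 * \<delta> \<le> \<epsilon>" "4 * \<delta> < 1"
    using \<open>0 < \<epsilon>\<close> by (auto simp: \<delta>_def min_def)
  obtain B where B: "finite B" "span B = E"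
    using E(1) unfolding finite_dim_subspace_def by blast
  obtain A where A: "finite A" "\<And>y. y \<in> A \<Longrightarrow> norm y = 1"
    and norming: "\<And>T. T \<in> E \<Longrightarrow> \<exists>y\<in>A. (1 - 3 * \<delta>) * norm T \<le> norm (T y)"
    using finite_norming_set[OF assms(1) E(1) \<delta>(1,2)] by blast
  define D where "D = (\<lambda>(T, y). blinfun_apply T y) ` (B \<times> A)"
  have "finite D" unfolding D_def using A(1) B(1) by simp
  have in_span: "T y \<in> span D" if T: "T \<in> E" and y: "y \<in> A" for T y
  proof -
    have lin: "linear (\<lambda>T :: 'y \<Rightarrow>\<^sub>L 'x. blinfun_apply T y)"
      by (intro linearI) (simp_all add: blinfun.add_left blinfun.scaleR_left)
    have "T y \<in> (\<lambda>T. blinfun_apply T y) ` span B" using T B(2) by blast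
    also have "\<dots> = span ((\<lambda>T. blinfun_apply T y) ` B)"
      by (rule linear_span_image[OF lin, symmetric])
    also have "\<dots> \<subseteq> span D"
      using y by (intro span_mono) (auto simp: D_def)
    finally show ?thesis .
  qed
  obtain S :: "'y \<Rightarrow>\<^sub>L 'x" where S: "finite_rank S" "norm S \<le> 1" and
    indep: "\<And>x y c. x \<in> span D \<Longrightarrow> y \<in> A \<Longrightarrow>
      (1 - \<delta>) * (norm x + \<bar>c\<bar> * (1 - 3 * \<delta>)) \<le> norm (x + c *\<^sub>R S y)"
    using finite_rank_contraction_almost_l1_independent
      [OF assms(2-4) A \<open>finite D\<close> \<delta>(1,2)] by blast
  have main: "(1 - 4 * \<delta>) * (norm T + \<bar>c\<bar>) \<le> norm (T + c *\<^sub>R S)" if T: "T \<in> E" for T c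
  proof -
    obtain y where y: "y \<in> A" "(1 - 3 * \<delta>) * norm T \<le> norm (T y)"
      using norming[OF T] by blast
    have "1 - 4 * \<delta> \<le> (1 - \<delta>) * (1 - 3 * \<delta>)" using \<delta> by (simp add: algebra_simps)
    then have "(1 - 4 * \<delta>) * (norm T + \<bar>c\<bar>) \<le> (1 - \<delta>) * (1 - 3 * \<delta>) * (norm T + \<bar>c\<bar>)"
      by (intro mult_right_mono) auto
    also have "\<dots> = (1 - \<delta>) * ((1 - 3 * \<delta>) * norm T + \<bar>c\<bar> * (1 - 3 * \<delta>))"
      by (simp add: algebra_simps)
    also have "\<dots> \<le> (1 - \<delta>) * (norm (T y) + \<bar>c\<bar> * (1 - 3 * \<delta>))"
      using y(2) \<delta> by (intro mult_left_mono add_right_mono) auto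
    also have "\<dots> \<le> norm (T y + c *\<^sub>R S y)"
      by (rule indep[OF in_span[OF T y(1)] y(1)])
    also have "\<dots> = norm ((T + c *\<^sub>R S) y)"
      by (simp add: blinfun.add_left blinfun.scaleR_left)
    also have "\<dots> \<le> norm (T + c *\<^sub>R S)"
      using norm_blinfun[of "T + c *\<^sub>R S" y] A(2)[OF y(1)] by simp
    finally show ?thesis .
  qed
  have "0 \<in> E" using B(2) span_zero by blast
  then have "1 - 4 * \<delta> \<le> norm S" using main[of 0 1] by simp
  then have S0: "0 < norm S" using \<delta>(4) by linarith
  \<comment> \<open>As \<open>norm S \<le> 1\<close>, normalising \<open>S\<close> only enlarges the coefficient \<open>c\<close>, and nothing is lost.\<close>
  define Z where "Z = (1 / norm S) *\<^sub>R S"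
  have "norm Z = 1" using S0 by (simp add: Z_def)
  moreover have "Z \<in> H"
    using S(1) assms(5,6) by (auto simp: Z_def intro: subspace_scale)
  moreover have "(1 - \<epsilon>) * (norm T + \<bar>c\<bar>) \<le> norm (T + c *\<^sub>R Z)" if T: "T \<in> E" for T c
  proof -
    have "\<bar>c\<bar> * norm S \<le> \<bar>c\<bar>" using S(2) by (simp add: mult_left_le)
    then have "\<bar>c\<bar> \<le> \<bar>c / norm S\<bar>" using S0 by (simp add: field_simps)
    moreover have "(1 - \<epsilon>) * (norm T + \<bar>c\<bar>) \<le> (1 - 4 * \<delta>) * (norm T + \<bar>c\<bar>)"
      using \<delta>(3) by (intro mult_right_mono) auto
    ultimately have "(1 - \<epsilon>) * (norm T + \<bar>c\<bar>) \<le> (1 - 4 * \<delta>) * (norm T + \<bar>c / norm S\<bar>)"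
      using \<delta>(4) by (smt (verit) mult_left_mono)
    also have "\<dots> \<le> norm (T + (c / norm S) *\<^sub>R S)" by (rule main[OF T])
    finally show ?thesis by (simp add: Z_def)
  qed
  ultimately show "\<exists>z\<in>H. norm z = 1 \<and>
    (\<forall>y\<in>E. \<forall>c. (1 - \<epsilon>) * (norm y + \<bar>c\<bar>) \<le> norm (y + c *\<^sub>R z))"
    by blast
qed

end
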